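(* Let $n\ge 1$ and let $\mathbf{A}\in\mathbb{C}^{n\times n}$ be normal. If $z\in\mathbb{C}$ is a fremdervalue of $\mathbf{A}$, then the following three conditions hold. (i) $\min\mathrm{Re}(\lambda(\mathbf{A}))\le\mathrm{Re}(z)\le\max\mathrm{Re}(\lambda(\mathbf{A}))$. (ii) $\min\mathrm{Im}(\lambda(\mathbf{A}))\le\mathrm{Im}(z)\le\max\mathrm{Im}(\lambda(\mathbf{A}))$. (iii) Equality cannot be attained in both (i) and (ii): it is not the case that both $\mathrm{Re}(z)\in\{\min\mathrm{Re}(\lambda(\mathbf{A})),\max\mathrm{Re}(\lambda(\mathbf{A}))\}$ and $\mathrm{Im}(z)\in\{\min\mathrm{Im}(\lambda(\mathbf{A})),\max\mathrm{Im}(\lambda(\mathbf{A}))\}$.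
   Context: $\langle\cdot,\cdot\rangle$ is the usual inner product on $\mathbb{C}^n$, $\mathbf{M}^\dagger$ is the conjugate transpose of $\mathbf{M}$, $\lambda(\mathbf{M})$ is the spectrum of $\mathbf{M}$, and $\mathrm{Re}(\lambda(\mathbf{M}))$, $\mathrm{Im}(\lambda(\mathbf{M}))$ are the sets of real and imaginary parts of the elements of $\lambda(\mathbf{M})$. For $\mathbf{M}\in\mathbb{C}^{n\times n}$, a fremdervector of $\mathbf{M}$ is a vector $x\in\mathbb{C}^n$ with $\langle x,\mathbf{M}x\rangle=0$; it is nontrivial if $x\notin\ker(\mathbf{M})\cup\ker(\mathbf{M}^\dagger)$. A scalar $z\in\mathbb{C}$ is a fremdervalue of $\mathbf{A}$ if $z\mathbf{I}-\mathbf{A}$ has a nontrivial fremdervector. *)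

theory Defs
  imports
    "Jordan_Normal_Form.Matrix_Kernel"
    "Jordan_Normal_Form.Schur_Decomposition"
    "Jordan_Normal_Form.Spectral_Radius"
begin

(* The definitions below are meant for square matrices. *)

definition normal_mat :: "complex mat \<Rightarrow> bool" where
  "normal_mat A \<longleftrightarrow> A * mat_adjoint A = mat_adjoint A * A"

(* The inner product \<bullet>c is linear in its first and conjugate-linear in its second argument;
   the opposite convention conjugates the value and so gives the same fremdervectors. *)
definition fremdervector :: "complex mat \<Rightarrow> complex vec \<Rightarrow> bool" where
  "fremdervector M x \<longleftrightarrow> x \<in> carrier_vec (dim_row M) \<and> x \<bullet>c (M *\<^sub>v x) = 0"

definition nontrivial_fremdervector :: "complex mat \<Rightarrow> complex vec \<Rightarrow> bool" where
  "nontrivial_fremdervector M x \<longleftrightarrow>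
     fremdervector M x \<and> x \<notin> mat_kernel M \<union> mat_kernel (mat_adjoint M)"

definition fremdervalue :: "complex mat \<Rightarrow> complex \<Rightarrow> bool" where
  "fremdervalue A z \<longleftrightarrow> (\<exists>x. nontrivial_fremdervector (z \<cdot>\<^sub>m 1\<^sub>m (dim_row A) - A) x)"

end

theory Submission
  imports Defs
begin

text \<open>
  A normal matrix \<open>A\<close> splits every vector \<open>x\<close> into pairwise orthogonal eigenvectors
  \<open>v e\<close>, one for each \<open>e\<close> in the spectrum (the zero vector being allowed). If \<open>x\<close> is a
  fremdervector of \<open>z I - A\<close>, Pythagoras turns the defining equation into
  \<open>\<Sum>e. (e - z) * q e = 0\<close> with weights \<open>q e = \<parallel>v e\<parallel>\<^sup>2 \<ge> 0\<close>; and since \<open>x\<close> is not in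
  the kernel of \<open>z I - A\<close>, some eigenvalue \<open>d \<noteq> z\<close> has positive weight. This is
  \<open>fremdervalue_weighted_mean\<close>. Hence \<open>Re z\<close> is a weighted mean of the real parts of the
  eigenvalues, and \<open>Im z\<close> one of the imaginary parts, which gives the bounds. A mean equals an
  extreme value only if every value of positive weight does (\<open>weighted_mean_Min_Max\<close>), so
  equality in both coordinates would give \<open>Re d = Re z\<close> and \<open>Im d = Im z\<close>, that is \<open>d = z\<close>.

  The eigenvector decomposition (\<open>normal_mat_eigen_decomp\<close>) starts from a triangularization
  \<open>A P = P B\<close>, which need not be unitary. If \<open>b\<close> is the \<open>j\<close>-th diagonal entry of \<open>B\<close>,
  then \<open>A - b I\<close> maps the \<open>j\<close>-th column of \<open>P\<close> into the span of the earlier ones.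
  For normal \<open>A\<close> and an eigenvalue \<open>b\<close>, a vector is a sum of eigenvectors as soon as its
  image under \<open>A - b I\<close> is (\<open>eigen_decomp_lift\<close>). By induction all columns of \<open>P\<close> are
  sums of eigenvectors; they span the space because \<open>P\<close> is invertible.
\<close>

section \<open>Inner products and the adjoint\<close>

lemma cscalar_prod_sum:
  fixes x y :: "complex vec"
  assumes "x \<in> carrier_vec n" "y \<in> carrier_vec n"
  shows "x \<bullet>c y = (\<Sum>i<n. x $ i * cnj (y $ i))"
  using assms by (auto simp: scalar_prod_def atLeast0LessThan)

lemma cscalar_prod_self:
  fixes x :: "complex vec"
  assumes "x \<in> carrier_vec n"
  shows "x \<bullet>c x = of_real (\<Sum>i<n. (cmod (x $ i))\<^sup>2)"
  using assms by (simp add: cscalar_prod_sum complex_norm_square del: of_real_power)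

lemma cscalar_prod_self_Re:
  fixes x :: "complex vec"
  assumes "x \<in> carrier_vec n"
  shows "x \<bullet>c x = of_real (Re (x \<bullet>c x))" "0 \<le> Re (x \<bullet>c x)"
  using assms by (auto simp: cscalar_prod_self intro!: sum_nonneg)

lemma cnj_cscalar_prod:
  fixes x y :: "complex vec"
  assumes "x \<in> carrier_vec n" "y \<in> carrier_vec n"
  shows "cnj (x \<bullet>c y) = y \<bullet>c x"
  using assms by (simp add: cscalar_prod_sum mult.commute)

lemma cscalar_prod_minus_left:
  fixes x :: "complex vec"
  assumes "x \<in> carrier_vec n" "y \<in> carrier_vec n" "w \<in> carrier_vec n"
  shows "(x - y) \<bullet>c w = x \<bullet>c w - y \<bullet>c w"
  using assms by (simp add: cscalar_prod_sum[of _ n] left_diff_distrib sum_subtractf)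

lemma cscalar_prod_minus_right:
  fixes x :: "complex vec"
  assumes "x \<in> carrier_vec n" "y \<in> carrier_vec n" "w \<in> carrier_vec n"
  shows "w \<bullet>c (x - y) = w \<bullet>c x - w \<bullet>c y"
  using assms by (simp add: cscalar_prod_sum[of _ n] right_diff_distrib sum_subtractf)

lemma cscalar_prod_smult_left:
  fixes x y :: "complex vec"
  assumes "x \<in> carrier_vec n" "y \<in> carrier_vec n"
  shows "(c \<cdot>\<^sub>v x) \<bullet>c y = c * (x \<bullet>c y)"
  using assms by (simp add: cscalar_prod_sum sum_distrib_left mult.assoc)

lemma cscalar_prod_smult_right:
  fixes x y :: "complex vec"
  assumes "x \<in> carrier_vec n" "y \<in> carrier_vec n"
  shows "x \<bullet>c (c \<cdot>\<^sub>v y) = cnj c * (x \<bullet>c y)"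
  using assms by (simp add: cscalar_prod_sum sum_distrib_left mult_ac)

lemma cscalar_prod_diff_eq_0:
  fixes x y :: "complex vec"
  assumes x: "x \<in> carrier_vec n" and y: "y \<in> carrier_vec n" and "(x - y) \<bullet>c (x - y) = 0"
  shows "x = y"
proof -
  have "x - y = 0\<^sub>v n"
    using assms conjugate_square_eq_0_vec[of "x - y" n] by auto
  hence "(x - y) $ i = 0" if "i < n" for i
    using that by simp
  thus ?thesis using x y by (intro eq_vecI) auto
qed

lemma mat_adjoint_carrier:
  assumes "A \<in> carrier_mat n n"
  shows "mat_adjoint A \<in> carrier_mat n n"
  using assms by (auto simp: mat_adjoint_def)

lemma mat_adjoint_index:
  assumes "A \<in> carrier_mat n n" "i < n" "j < n"
  shows "mat_adjoint A $$ (i, j) = cnj (A $$ (j, i))"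
  using assms by (auto simp: mat_adjoint_def mat_of_rows_def)

lemma mult_mat_vec_index_sum:
  assumes "A \<in> carrier_mat n n" "x \<in> carrier_vec n" "i < n"
  shows "(A *\<^sub>v x) $ i = (\<Sum>k<n. A $$ (i, k) * x $ k)"
  using assms by (auto simp: scalar_prod_def atLeast0LessThan)

lemma mat_adjoint_cscalar_prod:
  fixes A :: "complex mat"
  assumes A: "A \<in> carrier_mat n n" and x: "x \<in> carrier_vec n" and y: "y \<in> carrier_vec n"
  shows "(A *\<^sub>v x) \<bullet>c y = x \<bullet>c (mat_adjoint A *\<^sub>v y)"
proof -
  note A' = mat_adjoint_carrier[OF A]
  have "(A *\<^sub>v x) \<bullet>c y = (\<Sum>i<n. \<Sum>k<n. A $$ (i, k) * x $ k * cnj (y $ i))"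
    using assms by (subst cscalar_prod_sum[of _ n])
      (auto simp: mult_mat_vec_index_sum[OF A x] sum_distrib_right simp del: index_mult_mat_vec
        intro!: sum.cong)
  also have "\<dots> = (\<Sum>k<n. \<Sum>i<n. A $$ (i, k) * x $ k * cnj (y $ i))"
    by (rule sum.swap)
  also have "\<dots> = x \<bullet>c (mat_adjoint A *\<^sub>v y)"
    using assms A' by (subst cscalar_prod_sum[of _ n])
      (auto simp: mult_mat_vec_index_sum[OF A' y] sum_distrib_left mat_adjoint_index[OF A] mult_ac
        simp del: index_mult_mat_vec intro!: sum.cong)
  finally show ?thesis .
qed

section \<open>Eigenvectors of a normal matrix\<close>

lemma normal_mat_adjoint_norm:
  assumes A: "A \<in> carrier_mat n n" and normal: "normal_mat A" and x: "x \<in> carrier_vec n"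
  shows "(mat_adjoint A *\<^sub>v x) \<bullet>c (mat_adjoint A *\<^sub>v x) = (A *\<^sub>v x) \<bullet>c (A *\<^sub>v x)"
proof -
  note A' = mat_adjoint_carrier[OF A]
  have "(mat_adjoint A *\<^sub>v x) \<bullet>c (mat_adjoint A *\<^sub>v x) = (A *\<^sub>v (mat_adjoint A *\<^sub>v x)) \<bullet>c x"
    using mat_adjoint_cscalar_prod[OF A, of "mat_adjoint A *\<^sub>v x" x] A' x by auto
  also have "A *\<^sub>v (mat_adjoint A *\<^sub>v x) = mat_adjoint A *\<^sub>v (A *\<^sub>v x)"
    using normal A A' x unfolding normal_mat_def by (metis assoc_mult_mat_vec)
  also have "\<dots> \<bullet>c x = cnj (x \<bullet>c (mat_adjoint A *\<^sub>v (A *\<^sub>v x)))"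
    using A A' x by (subst cnj_cscalar_prod[of _ n]) auto
  also have "\<dots> = (A *\<^sub>v x) \<bullet>c (A *\<^sub>v x)"
    using mat_adjoint_cscalar_prod[OF A x, of "A *\<^sub>v x"] A x
      cnj_cscalar_prod[of "A *\<^sub>v x" n "A *\<^sub>v x"] by simp
  finally show ?thesis .
qed

text \<open>
  Since \<open>A\<close> and its adjoint stretch every vector equally, all four terms in the expansion of
  the squared norm of the difference of both sides are \<open>\<bar>e\<bar>\<^sup>2 * \<parallel>y\<parallel>\<^sup>2\<close> up to sign, and they cancel.
\<close>
lemma normal_mat_adjoint_eigenvector:
  assumes A: "A \<in> carrier_mat n n" and normal: "normal_mat A" and y: "y \<in> carrier_vec n"
    and eig: "A *\<^sub>v y = e \<cdot>\<^sub>v y"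
  shows "mat_adjoint A *\<^sub>v y = cnj e \<cdot>\<^sub>v y"
proof -
  note A' = mat_adjoint_carrier[OF A]
  define w where "w = mat_adjoint A *\<^sub>v y"
  have w: "w \<in> carrier_vec n" using A' y by (auto simp: w_def)
  have ww: "w \<bullet>c w = e * cnj e * (y \<bullet>c y)"
    using normal_mat_adjoint_norm[OF A normal y] y
    by (simp add: w_def eig cscalar_prod_smult_left[of _ n] cscalar_prod_smult_right[of _ n])
  have yw: "y \<bullet>c w = e * (y \<bullet>c y)"
    using mat_adjoint_cscalar_prod[OF A y y] y
    by (simp add: w_def eig cscalar_prod_smult_left[of _ n])
  have wy: "w \<bullet>c y = cnj e * (y \<bullet>c y)"
    using cnj_cscalar_prod[OF y w] cnj_cscalar_prod[OF y y] by (simp add: yw)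
  have "(w - cnj e \<cdot>\<^sub>v y) \<bullet>c (w - cnj e \<cdot>\<^sub>v y) = 0"
    using w y
    by (simp add: cscalar_prod_minus_left[of _ n] cscalar_prod_minus_right[of _ n]
        cscalar_prod_smult_left[of _ n] cscalar_prod_smult_right[of _ n] ww yw wy algebra_simps)
  thus ?thesis
    using cscalar_prod_diff_eq_0[OF w, of "cnj e \<cdot>\<^sub>v y"] y by (simp add: w_def)
qed

lemma normal_mat_eigenvectors_orthogonal:
  assumes A: "A \<in> carrier_mat n n" and normal: "normal_mat A"
    and x: "x \<in> carrier_vec n" "A *\<^sub>v x = d \<cdot>\<^sub>v x"
    and y: "y \<in> carrier_vec n" "A *\<^sub>v y = e \<cdot>\<^sub>v y"
    and "d \<noteq> e"
  shows "x \<bullet>c y = 0"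
proof -
  have "d * (x \<bullet>c y) = e * (x \<bullet>c y)"
    using mat_adjoint_cscalar_prod[OF A x(1) y(1)] x y
    by (simp add: normal_mat_adjoint_eigenvector[OF A normal y] cscalar_prod_smult_left[of _ n]
        cscalar_prod_smult_right[of _ n])
  thus ?thesis using \<open>d \<noteq> e\<close> by simp
qed

text \<open>
  All Jordan blocks of a normal matrix have size one: \<open>y = (A - e I) x\<close> lies in the range of
  \<open>A - e I\<close>, whereas an eigenvector for \<open>e\<close> is killed by the adjoint of \<open>A - e I\<close>
  and so is orthogonal to that range. Thus \<open>y\<close> is orthogonal to itself.
\<close>
lemma normal_mat_no_generalized_eigenvector:
  assumes A: "A \<in> carrier_mat n n" and normal: "normal_mat A" and x: "x \<in> carrier_vec n"
    and y: "y = A *\<^sub>v x - e \<cdot>\<^sub>v x" and eig: "A *\<^sub>v y = e \<cdot>\<^sub>v y"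
  shows "A *\<^sub>v x = e \<cdot>\<^sub>v x"
proof -
  have yc: "y \<in> carrier_vec n" using A x y by auto
  have "y \<bullet>c y = (A *\<^sub>v x) \<bullet>c y - e * (x \<bullet>c y)"
    unfolding y(1) by (subst (1) cscalar_prod_minus_left[of _ n], insert A x yc y)
      (auto simp: cscalar_prod_smult_left[of _ n])
  also have "(A *\<^sub>v x) \<bullet>c y = e * (x \<bullet>c y)"
    using mat_adjoint_cscalar_prod[OF A x yc] x yc
    by (simp add: normal_mat_adjoint_eigenvector[OF A normal yc eig]
        cscalar_prod_smult_right[of _ n])
  finally have "y \<bullet>c y = 0" by simp
  thus ?thesis
    using cscalar_prod_diff_eq_0[of "A *\<^sub>v x" n "e \<cdot>\<^sub>v x"] A x by (simp add: y)
qed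

section \<open>Decomposition into eigenvectors\<close>

text \<open>
  Indexing the summands by all scalars, with a sum over the spectrum only, allows decompositions
  to be combined summand by summand: each eigenspace is closed under linear combinations. Outside
  the spectrum the condition forces \<open>v e = 0\<close>.
\<close>
definition eigen_decomp :: "complex mat \<Rightarrow> complex vec \<Rightarrow> (complex \<Rightarrow> complex vec) \<Rightarrow> bool" where
  "eigen_decomp A x v \<longleftrightarrow>
     (\<forall>e. v e \<in> carrier_vec (dim_row A) \<and> A *\<^sub>v v e = e \<cdot>\<^sub>v v e) \<and>
     x = vec (dim_row A) (\<lambda>i. \<Sum>e\<in>spectrum A. v e $ i)"

lemma eigen_decompD:
  assumes "eigen_decomp A x v" and "A \<in> carrier_mat n n"
  shows "v e \<in> carrier_vec n" "A *\<^sub>v v e = e \<cdot>\<^sub>v v e" "x \<in> carrier_vec n"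
    "i < n \<Longrightarrow> x $ i = (\<Sum>e\<in>spectrum A. v e $ i)"
  using assms by (auto simp: eigen_decomp_def)

lemma eigen_decomp_mult:
  assumes A: "A \<in> carrier_mat n n" and dec: "eigen_decomp A x v" and i: "i < n"
  shows "(A *\<^sub>v x) $ i = (\<Sum>e\<in>spectrum A. e * v e $ i)"
proof -
  note D = eigen_decompD[OF dec A]
  have "(A *\<^sub>v x) $ i = (\<Sum>k<n. \<Sum>e\<in>spectrum A. A $$ (i, k) * v e $ k)"
    by (simp add: mult_mat_vec_index_sum[OF A D(3) i] D(4) sum_distrib_left
        del: index_mult_mat_vec)
  also have "\<dots> = (\<Sum>e\<in>spectrum A. \<Sum>k<n. A $$ (i, k) * v e $ k)"
    by (rule sum.swap)
  also have "\<dots> = (\<Sum>e\<in>spectrum A. (A *\<^sub>v v e) $ i)"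
    by (simp add: mult_mat_vec_index_sum[OF A D(1) i] del: index_mult_mat_vec)
  also have "\<dots> = (\<Sum>e\<in>spectrum A. e * v e $ i)"
    using D(1)[THEN carrier_vecD] i by (simp add: D(2))
  finally show ?thesis .
qed

lemma eigen_decomp_lincomb:
  assumes A: "A \<in> carrier_mat n n" and "\<And>j. j \<in> J \<Longrightarrow> \<exists>v. eigen_decomp A (p j) v"
  shows "\<exists>v. eigen_decomp A (vec n (\<lambda>i. \<Sum>j\<in>J. c j * p j $ i)) v"
proof -
  from assms(2) obtain v where v: "\<And>j. j \<in> J \<Longrightarrow> eigen_decomp A (p j) (v j)" by metis
  note D = eigen_decompD[OF v A]
  define u where "u e = vec n (\<lambda>i. \<Sum>j\<in>J. c j * v j e $ i)" for e
  have u: "u e \<in> carrier_vec n" for e by (simp add: u_def)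
  have "A *\<^sub>v u e = e \<cdot>\<^sub>v u e" for e
  proof (rule eq_vecI)
    fix i assume "i < dim_vec (e \<cdot>\<^sub>v u e)"
    hence i: "i < n" by (simp add: u_def)
    have "(A *\<^sub>v u e) $ i = (\<Sum>k<n. \<Sum>j\<in>J. c j * (A $$ (i, k) * v j e $ k))"
      by (simp add: mult_mat_vec_index_sum[OF A u i] del: index_mult_mat_vec)
        (simp add: u_def sum_distrib_left mult_ac)
    also have "\<dots> = (\<Sum>j\<in>J. \<Sum>k<n. c j * (A $$ (i, k) * v j e $ k))"
      by (rule sum.swap)
    also have "\<dots> = (\<Sum>j\<in>J. c j * (A *\<^sub>v v j e) $ i)"
      by (intro sum.cong refl)
        (simp add: mult_mat_vec_index_sum[OF A D(1) i] sum_distrib_left del: index_mult_mat_vec)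
    also have "\<dots> = (\<Sum>j\<in>J. e * (c j * v j e $ i))"
      using D(1)[THEN carrier_vecD] i by (intro sum.cong refl) (simp add: D(2))
    also have "\<dots> = (e \<cdot>\<^sub>v u e) $ i"
      using i by (simp add: u_def sum_distrib_left)
    finally show "(A *\<^sub>v u e) $ i = (e \<cdot>\<^sub>v u e) $ i" .
  qed (use A in \<open>simp add: u_def\<close>)
  moreover have "vec n (\<lambda>i. \<Sum>j\<in>J. c j * p j $ i) = vec n (\<lambda>i. \<Sum>e\<in>spectrum A. u e $ i)"
  proof (rule eq_vecI)
    fix i assume "i < dim_vec (vec n (\<lambda>i. \<Sum>e\<in>spectrum A. u e $ i))"
    hence i: "i < n" by simp
    have "(\<Sum>j\<in>J. c j * p j $ i) = (\<Sum>j\<in>J. \<Sum>e\<in>spectrum A. c j * v j e $ i)"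
      by (intro sum.cong refl) (simp add: D(4) i sum_distrib_left)
    also have "\<dots> = (\<Sum>e\<in>spectrum A. \<Sum>j\<in>J. c j * v j e $ i)" by (rule sum.swap)
    finally show "vec n (\<lambda>i. \<Sum>j\<in>J. c j * p j $ i) $ i = vec n (\<lambda>i. \<Sum>e\<in>spectrum A. u e $ i) $ i"
      using i by (simp add: u_def)
  qed simp
  ultimately have "eigen_decomp A (vec n (\<lambda>i. \<Sum>j\<in>J. c j * p j $ i)) u"
    using A u by (simp add: eigen_decomp_def)
  thus ?thesis by blast
qed

text \<open>
  Let \<open>w\<close> be the summands of \<open>(A - e I) x\<close>. On the eigenspace of \<open>d \<noteq> e\<close> the matrix
  \<open>A - e I\<close> acts as the nonzero scalar \<open>d - e\<close>, so these summands can be divided out.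
  The remainder \<open>r\<close> of \<open>x\<close> satisfies \<open>(A - e I) r = w e\<close>; as there are no
  generalized eigenvectors, \<open>r\<close> is itself an eigenvector for \<open>e\<close>.
\<close>
lemma eigen_decomp_lift:
  assumes A: "A \<in> carrier_mat n n" and normal: "normal_mat A" and x: "x \<in> carrier_vec n"
    and e: "e \<in> spectrum A" and ex: "\<exists>w. eigen_decomp A (A *\<^sub>v x - e \<cdot>\<^sub>v x) w"
  shows "\<exists>v. eigen_decomp A x v"
proof -
  from ex obtain w where w: "eigen_decomp A (A *\<^sub>v x - e \<cdot>\<^sub>v x) w" ..
  note W = eigen_decompD[OF w A]
  have fin: "finite (spectrum A)" using card_finite_spectrum[OF A] by simp
  define u where "u d = (if d = e then 0\<^sub>v n else (1 / (d - e)) \<cdot>\<^sub>v w d)" for d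
  define s where "s = vec n (\<lambda>i. \<Sum>d\<in>spectrum A. u d $ i)"
  have Au: "A *\<^sub>v u d = d \<cdot>\<^sub>v u d" for d
    using A W(1,2)[of d] by (auto simp: u_def mult_mat_vec smult_smult_assoc mult.commute)
  have uc: "u d \<in> carrier_vec n" for d using W(1) by (simp add: u_def)
  have dec_s: "eigen_decomp A s u"
    using A Au uc by (simp add: eigen_decomp_def s_def)
  have sc: "s \<in> carrier_vec n" by (simp add: s_def)
  define r where "r = x - s"
  have rc: "r \<in> carrier_vec n" using x sc by (simp add: r_def)
  have Ar: "A *\<^sub>v r - e \<cdot>\<^sub>v r = w e"
  proof (rule eq_vecI)
    fix i assume "i < dim_vec (w e)"
    hence i: "i < n" using W(1)[of e] by simp
    have "(A *\<^sub>v r) $ i = (A *\<^sub>v x) $ i - (A *\<^sub>v s) $ i"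
      unfolding r_def using A x sc i by (simp add: mult_minus_distrib_mat_vec del: index_mult_mat_vec)
    hence "(A *\<^sub>v r - e \<cdot>\<^sub>v r) $ i
        = (A *\<^sub>v x - e \<cdot>\<^sub>v x) $ i - ((A *\<^sub>v s) $ i - e * s $ i)"
      using A x sc rc i by (simp add: r_def algebra_simps del: index_mult_mat_vec)
    also have "(A *\<^sub>v s) $ i - e * s $ i = (\<Sum>d\<in>spectrum A. (d - e) * u d $ i)"
      using i by (simp add: eigen_decomp_mult[OF A dec_s] eigen_decompD(4)[OF dec_s A]
          sum_distrib_left sum_subtractf left_diff_distrib del: index_mult_mat_vec)
    also have "\<dots> = (\<Sum>d\<in>spectrum A - {e}. w d $ i)"
      using i W(1)[THEN carrier_vecD]
      by (subst sum.remove[OF fin e]) (auto simp: u_def intro!: sum.cong)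
    also have "(A *\<^sub>v x - e \<cdot>\<^sub>v x) $ i - \<dots> = w e $ i"
      unfolding W(4)[OF i] by (subst sum.remove[OF fin e]) simp
    finally show "(A *\<^sub>v r - e \<cdot>\<^sub>v r) $ i = w e $ i" .
  qed (use rc W(1)[of e] in simp)
  have Ar': "A *\<^sub>v r = e \<cdot>\<^sub>v r"
    by (rule normal_mat_no_generalized_eigenvector[OF A normal rc Ar[symmetric] W(2)])
  have "eigen_decomp A x (u(e := r))"
    unfolding eigen_decomp_def
  proof (intro conjI allI)
    show "x = vec (dim_row A) (\<lambda>i. \<Sum>d\<in>spectrum A. (u(e := r)) d $ i)"
    proof (rule eq_vecI)
      fix i assume "i < dim_vec (vec (dim_row A) (\<lambda>i. \<Sum>d\<in>spectrum A. (u(e := r)) d $ i))"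
      hence i: "i < n" using A by simp
      have "s $ i = (\<Sum>d\<in>spectrum A - {e}. u d $ i)"
        using i by (simp add: s_def sum.remove[OF fin e]) (simp add: u_def)
      moreover have "(\<Sum>d\<in>spectrum A. (u(e := r)) d $ i)
          = r $ i + (\<Sum>d\<in>spectrum A - {e}. u d $ i)"
        by (subst sum.remove[OF fin e]) simp
      ultimately show "x $ i = vec (dim_row A) (\<lambda>i. \<Sum>d\<in>spectrum A. (u(e := r)) d $ i) $ i"
        using i A x sc by (simp add: r_def)
    qed (use A x in simp)
  qed (use A rc uc Au Ar' in auto)
  thus ?thesis by blast
qed

text \<open>
  The spectral theorem for normal matrices, in the form of a decomposition of each vector, by
  induction on the columns of a triangularizing matrix.
\<close>
lemma normal_mat_eigen_decomp:
  assumes A: "A \<in> carrier_mat n n" and normal: "normal_mat A" and x: "x \<in> carrier_vec n"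
  shows "\<exists>v. eigen_decomp A x v"
proof -
  from char_poly_factorized[OF A] obtain es
    where es: "char_poly A = (\<Prod>e\<leftarrow>es. [:- e, 1:])" "length es = n" by blast
  obtain B P Q where schur: "schur_decomposition A es = (B, P, Q)"
    by (cases "schur_decomposition A es") auto
  from schur_decomposition[OF A es(1) schur]
  have sim: "similar_mat_wit A B P Q" and ut: "upper_triangular B" and diag: "diag_mat B = es"
    by auto
  from similar_mat_witD2[OF A sim]
  have PQ: "P * Q = 1\<^sub>m n" and QP: "Q * P = 1\<^sub>m n" and ABP: "A = P * B * Q"
    and B: "B \<in> carrier_mat n n" and P: "P \<in> carrier_mat n n" and Q: "Q \<in> carrier_mat n n" by auto
  have AP: "A * P = P * B"
  proof -
    have "A * P = P * B * (Q * P)" unfolding ABP using B P Q by (simp add: assoc_mult_mat[of _ n n _ n _ n])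
    thus ?thesis using B P by (simp add: QP)
  qed
  have spec: "B $$ (j, j) \<in> spectrum A" if "j < n" for j
  proof -
    have "B $$ (j, j) \<in> set es"
      using that B unfolding diag[symmetric] diag_mat_def by auto
    thus ?thesis
      unfolding spectrum_root_char_poly[OF A] es(1)
      by (auto simp: poly_prod_list prod_list_zero_iff)
  qed
  have cols: "\<exists>v. eigen_decomp A (col P j) v" if "j < n" for j
    using that
  proof (induction j rule: less_induct)
    case (less j)
    have pj: "col P j \<in> carrier_vec n" using P by auto
    have "A *\<^sub>v col P j - B $$ (j, j) \<cdot>\<^sub>v col P j
        = vec n (\<lambda>i. \<Sum>k<j. B $$ (k, j) * col P k $ i)"
    proof (rule eq_vecI)
      fix i assume "i < dim_vec (vec n (\<lambda>i. \<Sum>k<j. B $$ (k, j) * col P k $ i))"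
      hence i: "i < n" by simp
      have "A *\<^sub>v col P j = col (P * B) j"
        using col_mult2[OF A P less.prems] by (simp add: AP)
      hence "(A *\<^sub>v col P j) $ i = (\<Sum>k<n. P $$ (i, k) * B $$ (k, j))"
        using P B i less.prems by (simp add: scalar_prod_def atLeast0LessThan del: index_mult_mat_vec)
      \<comment> \<open>The summand for \<open>k = j\<close> is the diagonal term subtracted on the left-hand side.\<close>
      also have "\<dots> = (\<Sum>k<Suc j. P $$ (i, k) * B $$ (k, j))"
        using less.prems B ut by (intro sum.mono_neutral_right) (auto simp: upper_triangularD)
      finally show "(A *\<^sub>v col P j - B $$ (j, j) \<cdot>\<^sub>v col P j) $ i
          = vec n (\<lambda>i. \<Sum>k<j. B $$ (k, j) * col P k $ i) $ i"
        using A P i less.prems by (simp add: mult.commute del: index_mult_mat_vec)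
    qed (use P in simp)
    moreover have "\<exists>v. eigen_decomp A (vec n (\<lambda>i. \<Sum>k<j. B $$ (k, j) * col P k $ i)) v"
      using less by (intro eigen_decomp_lincomb[OF A]) auto
    ultimately show ?case
      using eigen_decomp_lift[OF A normal pj spec[OF less.prems]] by simp
  qed
  have Qx: "Q *\<^sub>v x \<in> carrier_vec n" using Q x by auto
  have "x = P *\<^sub>v (Q *\<^sub>v x)"
    using P Q x by (simp add: assoc_mult_mat_vec[symmetric] PQ)
  also have "\<dots> = vec n (\<lambda>i. \<Sum>j<n. (Q *\<^sub>v x) $ j * col P j $ i)"
    using P Qx by (intro eq_vecI)
      (auto simp: mult_mat_vec_index_sum[OF P Qx] mult.commute simp del: index_mult_mat_vec)
  finally show ?thesis
    using eigen_decomp_lincomb[OF A, of "{..<n}" "col P" "\<lambda>j. (Q *\<^sub>v x) $ j"] cols by simp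
qed

section \<open>Fremdervalues as weighted means of the spectrum\<close>

text \<open>
  The left-hand side is \<open>f(A) x \<bullet>c x\<close>, where \<open>f(A)\<close> scales the summand for \<open>d\<close> by
  \<open>f d\<close>; orthogonality of the summands removes the mixed terms.
\<close>
lemma eigen_decomp_cscalar_prod:
  assumes A: "A \<in> carrier_mat n n" and normal: "normal_mat A" and dec: "eigen_decomp A x v"
  shows "(\<Sum>i<n. (\<Sum>d\<in>spectrum A. f d * v d $ i) * cnj (x $ i))
    = (\<Sum>d\<in>spectrum A. f d * (v d \<bullet>c v d))"
proof -
  note D = eigen_decompD[OF dec A]
  have fin: "finite (spectrum A)" using card_finite_spectrum[OF A] by simp
  have x: "v d \<bullet>c x = v d \<bullet>c v d" if d: "d \<in> spectrum A" for d
  proof -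
    have "v d \<bullet>c x = (\<Sum>i<n. \<Sum>e\<in>spectrum A. v d $ i * cnj (v e $ i))"
      by (simp add: cscalar_prod_sum[OF D(1) D(3)] D(4) sum_distrib_left)
    also have "\<dots> = (\<Sum>e\<in>spectrum A. v d \<bullet>c v e)"
      by (subst sum.swap) (simp add: cscalar_prod_sum[OF D(1) D(1)])
    also have "\<dots> = (\<Sum>e\<in>spectrum A. if e = d then v d \<bullet>c v d else 0)"
      using normal_mat_eigenvectors_orthogonal[OF A normal D(1,2) D(1,2)]
      by (intro sum.cong refl) auto
    finally show ?thesis using fin d by simp
  qed
  have "(\<Sum>i<n. (\<Sum>d\<in>spectrum A. f d * v d $ i) * cnj (x $ i))
      = (\<Sum>d\<in>spectrum A. \<Sum>i<n. f d * v d $ i * cnj (x $ i))"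
    by (subst sum.swap) (simp add: sum_distrib_right)
  also have "\<dots> = (\<Sum>d\<in>spectrum A. f d * (v d \<bullet>c x))"
    by (simp add: cscalar_prod_sum[OF D(1) D(3)] sum_distrib_left mult.assoc)
  finally show ?thesis by (simp add: x)
qed

text \<open>
  The fremdervector equation is \<open>f(A) x \<bullet>c x = 0\<close> for \<open>f d = z - d\<close>, with the squared
  norms of the summands of \<open>x\<close> as weights. If only the summand for \<open>z\<close> were nonzero, \<open>x\<close>
  would lie in the kernel of \<open>z I - A\<close>; this is where nontriviality enters.
\<close>
lemma fremdervalue_weighted_mean:
  assumes A: "A \<in> carrier_mat n n" and normal: "normal_mat A" and z: "fremdervalue A z"
  obtains q :: "complex \<Rightarrow> real" and d where "\<And>e. 0 \<le> q e"
    and "(\<Sum>e\<in>spectrum A. (e - z) * of_real (q e)) = 0"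
    and "d \<in> spectrum A" "d \<noteq> z" "q d > 0"
proof -
  define M where "M = z \<cdot>\<^sub>m 1\<^sub>m n - A"
  have M: "M \<in> carrier_mat n n" using A by (auto simp: M_def)
  from z A obtain x where x: "x \<in> carrier_vec n" and fr: "x \<bullet>c (M *\<^sub>v x) = 0"
    and ker: "x \<notin> mat_kernel M"
    by (auto simp: fremdervalue_def nontrivial_fremdervector_def fremdervector_def M_def)
  from normal_mat_eigen_decomp[OF A normal x] obtain v where dec: "eigen_decomp A x v" ..
  note D = eigen_decompD[OF dec A]
  have Mx: "(M *\<^sub>v x) $ i = (\<Sum>e\<in>spectrum A. (z - e) * v e $ i)" if i: "i < n" for i
  proof -
    have one: "(z \<cdot>\<^sub>m 1\<^sub>m n) *\<^sub>v x = z \<cdot>\<^sub>v x"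
    proof (rule eq_vecI)
      fix k assume "k < dim_vec (z \<cdot>\<^sub>v x)"
      hence k: "k < n" using x by simp
      show "((z \<cdot>\<^sub>m 1\<^sub>m n) *\<^sub>v x) $ k = (z \<cdot>\<^sub>v x) $ k"
        using x k by (subst mult_mat_vec_index_sum[of _ n]) (auto simp: if_distrib if_distribR cong: if_cong)
    qed (use x in simp)
    have "M *\<^sub>v x = z \<cdot>\<^sub>v x - A *\<^sub>v x"
      using A x one by (simp add: M_def minus_mult_distrib_mat_vec[of _ n n])
    hence "(M *\<^sub>v x) $ i = z * x $ i - (A *\<^sub>v x) $ i"
      using A x i by (simp del: index_mult_mat_vec)
    also have "\<dots> = (\<Sum>e\<in>spectrum A. (z - e) * v e $ i)"
      by (simp add: eigen_decomp_mult[OF A dec i] D(4)[OF i] sum_distrib_left sum_subtractf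
          left_diff_distrib del: index_mult_mat_vec)
    finally show ?thesis .
  qed
  have Mxc: "M *\<^sub>v x \<in> carrier_vec n" using M x by auto
  define q where "q e = Re (v e \<bullet>c v e)" for e
  have q: "v e \<bullet>c v e = of_real (q e)" "0 \<le> q e" for e
    using cscalar_prod_self_Re[OF D(1)[of e]] by (simp_all add: q_def)
  have "(\<Sum>e\<in>spectrum A. (z - e) * of_real (q e)) = (M *\<^sub>v x) \<bullet>c x"
    unfolding q(1)[symmetric] eigen_decomp_cscalar_prod[OF A normal dec, symmetric]
    by (simp add: cscalar_prod_sum[OF Mxc x] Mx del: index_mult_mat_vec)
  also have "\<dots> = 0" using cnj_cscalar_prod[OF x Mxc] fr by simp
  finally have "- (\<Sum>e\<in>spectrum A. (z - e) * of_real (q e)) = 0" by simp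
  hence mean: "(\<Sum>e\<in>spectrum A. (e - z) * of_real (q e)) = 0"
    by (simp add: sum_negf[symmetric] algebra_simps)
  have "\<exists>d\<in>spectrum A. d \<noteq> z \<and> v d \<noteq> 0\<^sub>v n"
  proof (rule ccontr)
    assume *: "\<not> ?thesis"
    have "M *\<^sub>v x = 0\<^sub>v n"
    proof (rule eq_vecI)
      fix i assume "i < dim_vec (0\<^sub>v n :: complex vec)"
      hence i: "i < n" by simp
      show "(M *\<^sub>v x) $ i = 0\<^sub>v n $ i"
        unfolding Mx[OF i] using * i by (auto intro!: sum.neutral)
    qed (use M in simp)
    thus False using ker mat_kernelI[OF M x] by blast
  qed
  then obtain d where d: "d \<in> spectrum A" "d \<noteq> z" "v d \<noteq> 0\<^sub>v n" by blast
  have "q d \<noteq> 0" using q(1)[of d] conjugate_square_eq_0_vec[OF D(1)[of d]] d by auto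
  with q(2) have "q d > 0" by (simp add: less_le)
  with that q(2) mean d show thesis by blast
qed

text \<open>
  If \<open>f - c\<close> has constant sign on \<open>S\<close>, the vanishing weighted sum forces every term to vanish,
  and so \<open>f d = c\<close>. This gives the case of equality; and if \<open>c\<close> were outside the range
  of \<open>f\<close>, the sign would also be constant, so \<open>c = f d\<close> would lie in that range after all.
\<close>
lemma weighted_mean_Min_Max:
  fixes f q :: "'a \<Rightarrow> real"
  assumes fin: "finite S" and q: "\<And>e. e \<in> S \<Longrightarrow> 0 \<le> q e" and d: "d \<in> S" "q d > 0"
    and mean: "(\<Sum>e\<in>S. (f e - c) * q e) = 0"
  shows "Min (f ` S) \<le> c" "c \<le> Max (f ` S)"
    and "c \<in> {Min (f ` S), Max (f ` S)} \<Longrightarrow> f d = c"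
proof -
  have eq: "f d = c" if "\<And>e. e \<in> S \<Longrightarrow> c \<le> f e"
  proof -
    have "(f d - c) * q d = 0"
      using sum_nonneg_0[OF fin _ mean d(1)] that q by simp
    thus ?thesis using d by simp
  qed
  have eq': "f d = c" if "\<And>e. e \<in> S \<Longrightarrow> f e \<le> c"
  proof -
    have "(\<Sum>e\<in>S. (c - f e) * q e) = - (\<Sum>e\<in>S. (f e - c) * q e)"
      by (simp add: sum_negf[symmetric] algebra_simps)
    hence "(c - f d) * q d = 0"
      using sum_nonneg_0[OF fin _ _ d(1), of "\<lambda>e. (c - f e) * q e"] that q mean by simp
    thus ?thesis using d by simp
  qed
  have bounds: "Min (f ` S) \<le> f e" "f e \<le> Max (f ` S)" if "e \<in> S" for e
    using fin that by auto
  show "Min (f ` S) \<le> c"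
  proof (rule ccontr)
    assume *: "\<not> ?thesis"
    hence "f d = c" using bounds(1) by (intro eq) force
    thus False using * bounds(1)[OF d(1)] by simp
  qed
  show "c \<le> Max (f ` S)"
  proof (rule ccontr)
    assume *: "\<not> ?thesis"
    hence "f d = c" using bounds(2) by (intro eq') force
    thus False using * bounds(2)[OF d(1)] by simp
  qed
  assume "c \<in> {Min (f ` S), Max (f ` S)}"
  thus "f d = c" using eq eq' bounds by auto
qed

theorem corollary4p7:
  fixes n :: nat and A :: "complex mat" and z :: complex
  assumes "n \<ge> 1"
    and "A \<in> carrier_mat n n"
    and "normal_mat A"
    and "fremdervalue A z"
  shows "(Min (Re ` spectrum A) \<le> Re z \<and> Re z \<le> Max (Re ` spectrum A))
    \<and> (Min (Im ` spectrum A) \<le> Im z \<and> Im z \<le> Max (Im ` spectrum A))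
    \<and> \<not> (Re z \<in> {Min (Re ` spectrum A), Max (Re ` spectrum A)}
          \<and> Im z \<in> {Min (Im ` spectrum A), Max (Im ` spectrum A)})"
proof -
  obtain q d where q: "\<And>e. 0 \<le> q e" and mean: "(\<Sum>e\<in>spectrum A. (e - z) * of_real (q e)) = 0"
    and d: "d \<in> spectrum A" "d \<noteq> z" "q d > 0"
    using fremdervalue_weighted_mean[OF assms(2-4)] by blast
  have fin: "finite (spectrum A)" using card_finite_spectrum[OF assms(2)] by simp
  have "(\<Sum>e\<in>spectrum A. (Re e - Re z) * q e) = 0" "(\<Sum>e\<in>spectrum A. (Im e - Im z) * q e) = 0"
    using arg_cong[OF mean, of Re] arg_cong[OF mean, of Im] by simp_all
  note re = weighted_mean_Min_Max[OF fin q d(1,3) this(1)]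
    and im = weighted_mean_Min_Max[OF fin q d(1,3) this(2)]
  show ?thesis using re im d(2) by (auto simp del: insert_iff simp: complex_eq_iff)
qed

end
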